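(* Let $d > 2$, let $k, n$ be positive integers, and let $T \subseteq [k]^d$ be a magic set of cardinality $nk$. Then for every partial Latin hypercube $C$ of length $k$ and type $T$, $$\mathrm{sgn}_1(C)^{d-1}\,\mathrm{sgn}_2(C)\cdots\mathrm{sgn}_d(C)\,\mathrm{ssgn}(C) = \mathrm{sgn}(T).$$
   Context: Elements of $[k]^d$ are called cells and are ordered lexicographically. A slice in direction $\ell \in [d]$ is the set of cells with a fixed $\ell$-th coordinate. A magic set is a subset $T \subseteq [k]^d$ having the same number of elements in every slice; if $|T| = nk$ this number is $n$. A partial Latin hypercube of length $k$ and type $T$ is a function $C:[k]^d \to \{0,1,\ldots,n\}$ with $C(a) \neq 0$ exactly for $a \in T$, such that for each slice $A$, the nonzero values $C(a)$, $a\in A$, listed in lexicographic order of $a$, form a permutation of $[n]$ (the $C$-permutation of $A$). $\mathrm{sgn}_\ell(C)$ is the product of the signs of the $C$-permutations of the $k$ slices in direction $\ell$. For each $i \in [n]$, the set $\{a : C(a) = i\}$ meets every slice exactly once, hence equals $\{(j, \pi_2(j), \ldots, \pi_d(j)) : j \in [k]\}$ for unique permutations $\pi_2,\ldots,\pi_d$ of $[k]$; the subsign of $i$ is $\mathrm{sgn}(\pi_2)\cdots\mathrm{sgn}(\pi_d)$, and $\mathrm{ssgn}(C)$ is the product of the subsigns over $i \in [n]$. For a sequence $a = (a_1,\ldots,a_N)$ of integers, $\mathrm{msgn}(a) := (-1)^{\#\{(i,j): i<j,\ a_i > a_j\}}$. If $x_1 < \cdots < x_{nk}$ are the elements of $T$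 in lexicographic order with $x_i = (x_i^{(1)},\ldots,x_i^{(d)})$, set $T_\ell := (x_1^{(\ell)},\ldots,x_{nk}^{(\ell)})$ and $\mathrm{sgn}(T) := \mathrm{msgn}(T_1)\cdots\mathrm{msgn}(T_d)$. *)

theory Defs
  imports "HOL-Combinatorics.Combinatorics" "HOL-Library.List_Lexorder"
begin

(* A cell (a_1, ..., a_d) of [k]^d is the list [a_1, ..., a_d].  The order on cells is the
   lexicographic order on lists from HOL-Library.List_Lexorder; sorted_list_of_set refers to it. *)

definition cells :: "nat \<Rightarrow> nat \<Rightarrow> nat list set" where
  "cells k d = {a. length a = d \<and> set a \<subseteq> {1..k}}"

(* Coordinates and directions are numbered from 1, list positions from 0. *)
definition coord :: "nat list \<Rightarrow> nat \<Rightarrow> nat" where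
  "coord a l = a ! (l - 1)"

definition slice :: "nat \<Rightarrow> nat \<Rightarrow> nat \<Rightarrow> nat \<Rightarrow> nat list set" where
  "slice k d l j = {a \<in> cells k d. coord a l = j}"

definition magic_set :: "nat \<Rightarrow> nat \<Rightarrow> nat list set \<Rightarrow> bool" where
  "magic_set k d T \<longleftrightarrow>
     T \<subseteq> cells k d \<and> (\<exists>m. \<forall>l\<in>{1..d}. \<forall>j\<in>{1..k}. card (T \<inter> slice k d l j) = m)"

definition C_word :: "(nat list \<Rightarrow> nat) \<Rightarrow> nat list set \<Rightarrow> nat list" where
  "C_word C A = filter (\<lambda>v. v \<noteq> 0) (map C (sorted_list_of_set A))"

(* Values of C outside [k]^d are unconstrained, and nothing below depends on them. *)
definition partial_latin_hypercube ::
    "nat \<Rightarrow> nat \<Rightarrow> nat \<Rightarrow> nat list set \<Rightarrow> (nat list \<Rightarrow> nat) \<Rightarrow> bool" where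
  "partial_latin_hypercube k d n T C \<longleftrightarrow>
     (\<forall>a\<in>cells k d. C a \<in> {0..n} \<and> (C a \<noteq> 0 \<longleftrightarrow> a \<in> T)) \<and>
     (\<forall>l\<in>{1..d}. \<forall>j\<in>{1..k}. C_word C (slice k d l j) \<in> permutations_of_set {1..n})"

(* The permutation of {1..length w} with one-line notation w, fixing every other number. *)
definition perm_of_word :: "nat list \<Rightarrow> nat \<Rightarrow> nat" where
  "perm_of_word w = (\<lambda>i. if i \<in> {1..length w} then w ! (i - 1) else i)"

definition dir_sgn :: "nat \<Rightarrow> nat \<Rightarrow> nat \<Rightarrow> (nat list \<Rightarrow> nat) \<Rightarrow> int" where
  "dir_sgn k d l C = (\<Prod>j=1..k. sign (perm_of_word (C_word C (slice k d l j))))"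

(* The permutations pi_2, ..., pi_d attached to the symbol i.  Requiring the identity at indices
   outside {2..d} only makes the family unique as a function on nat. *)
definition symbol_perms ::
    "nat \<Rightarrow> nat \<Rightarrow> (nat list \<Rightarrow> nat) \<Rightarrow> nat \<Rightarrow> nat \<Rightarrow> nat \<Rightarrow> nat" where
  "symbol_perms k d C i = (THE \<pi>.
     (\<forall>l\<in>{2..d}. \<pi> l permutes {1..k}) \<and> (\<forall>l. l \<notin> {2..d} \<longrightarrow> \<pi> l = id) \<and>
     {a \<in> cells k d. C a = i} = {j # map (\<lambda>l. \<pi> l j) [2..<d + 1] | j. j \<in> {1..k}})"

definition subsign :: "nat \<Rightarrow> nat \<Rightarrow> (nat list \<Rightarrow> nat) \<Rightarrow> nat \<Rightarrow> int" where
  "subsign k d C i = (\<Prod>l=2..d. sign (symbol_perms k d C i l))"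

definition ssgn :: "nat \<Rightarrow> nat \<Rightarrow> nat \<Rightarrow> (nat list \<Rightarrow> nat) \<Rightarrow> int" where
  "ssgn k d n C = (\<Prod>i=1..n. subsign k d C i)"

definition msgn :: "'a::linorder list \<Rightarrow> int" where
  "msgn w = (-1) ^ card {(i, j). i < j \<and> j < length w \<and> w ! i > w ! j}"

definition coord_word :: "nat list set \<Rightarrow> nat \<Rightarrow> nat list" where
  "coord_word T l = map (\<lambda>x. coord x l) (sorted_list_of_set T)"

definition set_sgn :: "nat \<Rightarrow> nat list set \<Rightarrow> int" where
  "set_sgn d T = (\<Prod>l=1..d. msgn (coord_word T l))"

end

theory Submission
  imports Defs
begin

text \<open>
  All signs are written as products of \<open>-1\<close> over the pairs of cells \<open>x < y\<close> of \<open>T\<close> satisfying some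
  condition.  For each direction \<open>l \<ge> 2\<close> the sign of the word \<open>T\<^sub>l\<close> is the product of \<open>sgn\<^sub>1(C)\<close>,
  \<open>sgn\<^sub>l(C)\<close> and the signs of the permutations \<open>\<pi>\<^sub>l\<close> of all symbols.  Indeed
  \<open>x \<mapsto> (x\<^sub>l, C x)\<close> is a bijection from \<open>T\<close> to \<open>[k] \<times> [n]\<close> for every \<open>l\<close>, so the number of pairs with
  \<open>x\<^sub>l < y\<^sub>l\<close> and \<open>C x > C y\<close> does not depend on \<open>l\<close>; inserting this number for \<open>1\<close> and for \<open>l\<close>, the
  identity holds for every single pair of cells.  Multiplying over \<open>l\<close> gives the theorem, because
  \<open>T\<^sub>1\<close> is weakly increasing.
\<close>

section \<open>Signs of relations on finite sets\<close>

text \<open>A product over all ordered pairs, rather than a power of -1, so that reindexing,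
  swapping and splitting are instances of laws for products, and multiplying two signs becomes
  exclusive or of the relations. Conditions such as \<open>x < y\<close> go into
  \<open>R\<close>.\<close>

definition pair_sgn :: "'a set \<Rightarrow> ('a \<Rightarrow> 'a \<Rightarrow> bool) \<Rightarrow> int" where
  "pair_sgn A R = (\<Prod>x\<in>A. \<Prod>y\<in>A. if R x y then -1 else 1)"

lemma pair_sgn_cong:
  "A = B \<Longrightarrow> (\<And>x y. x \<in> B \<Longrightarrow> y \<in> B \<Longrightarrow> R x y = S x y) \<Longrightarrow> pair_sgn A R = pair_sgn B S"
  unfolding pair_sgn_def by (auto intro!: prod.cong)

lemma pair_sgn_mult: "pair_sgn A R * pair_sgn A S = pair_sgn A (\<lambda>x y. R x y \<noteq> S x y)"
  unfolding pair_sgn_def prod.distrib[symmetric] by (auto intro!: prod.cong)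

lemma pair_sgn_swap: "pair_sgn A R = pair_sgn A (\<lambda>x y. R y x)"
  unfolding pair_sgn_def by (rule prod.swap)

lemma pair_sgn_bij:
  assumes "bij_betw g A B"
  shows "pair_sgn B R = pair_sgn A (\<lambda>x y. R (g x) (g y))"
  unfolding pair_sgn_def by (simp add: prod.reindex_bij_betw[OF assms, symmetric])

lemma pair_sgn_False: "(\<And>x y. x \<in> A \<Longrightarrow> y \<in> A \<Longrightarrow> \<not> R x y) \<Longrightarrow> pair_sgn A R = 1"
  unfolding pair_sgn_def by simp

lemma pair_sgn_card:
  assumes "finite A"
  shows "pair_sgn A R = (-1) ^ card {(x, y). x \<in> A \<and> y \<in> A \<and> R x y}"
proof -
  have *: "{(x, y). x \<in> A \<and> y \<in> A \<and> R x y} = (A \<times> A) \<inter> {(x, y). R x y}" by auto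
  have "pair_sgn A R = (\<Prod>p\<in>A \<times> A. if p \<in> {(x, y). R x y} then -1 else 1)"
    unfolding pair_sgn_def prod.cartesian_product by (auto intro!: prod.cong)
  also have "\<dots> = (\<Prod>p\<in>(A \<times> A) \<inter> {(x, y). R x y}. -1)"
    using assms by (subst prod.inter_restrict) auto
  finally show ?thesis by (simp add: *)
qed

text \<open>A pair with \<open>g x = g y\<close> lies in exactly one fibre, any other pair in none.
  Applied with \<open>g\<close> a coordinate (fibres are slices) and with \<open>g = C\<close>
  (fibres are symbol classes).\<close>

lemma pair_sgn_fibres:
  assumes "finite B" "\<And>x. x \<in> A \<Longrightarrow> g x \<in> B" "finite A"
  shows "(\<Prod>j\<in>B. pair_sgn {x\<in>A. g x = j} R) = pair_sgn A (\<lambda>x y. g x = g y \<and> R x y)"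
proof -
  have "(\<Prod>j\<in>B. pair_sgn {x\<in>A. g x = j} R)
      = (\<Prod>j\<in>B. \<Prod>x\<in>A. \<Prod>y\<in>A. if g x = j then (if g y = j \<and> R x y then -1 else 1) else 1)"
    unfolding pair_sgn_def prod.inter_filter[OF assms(3)]
    by (intro prod.cong refl) (auto intro!: prod.cong)
  also have "\<dots> = (\<Prod>x\<in>A. \<Prod>y\<in>A. \<Prod>j\<in>B. if g x = j then (if g y = j \<and> R x y then -1 else 1) else 1)"
    by (subst prod.swap, rule prod.cong[OF refl], rule prod.swap)
  also have "\<dots> = pair_sgn A (\<lambda>x y. g x = g y \<and> R x y)"
    unfolding pair_sgn_def using assms
    by (intro prod.cong refl) (auto simp: prod.delta)
  finally show ?thesis .
qed

text \<open>Each pair \<open>y < x\<close> is folded onto its increasing representative, where the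
  two contributions cancel if both orientations satisfy \<open>R\<close>. This restores the form
  \<open>x < y\<close> after reindexing along a map that does not preserve the order.\<close>

lemma pair_sgn_split_order:
  fixes A :: "'a::linorder set"
  assumes "\<And>x. x \<in> A \<Longrightarrow> \<not> R x x"
  shows "pair_sgn A R = pair_sgn A (\<lambda>x y. x < y \<and> R x y \<noteq> R y x)"
proof -
  have "pair_sgn A R = pair_sgn A (\<lambda>x y. (x < y \<and> R x y) \<noteq> (y < x \<and> R x y))"
    using assms by (intro pair_sgn_cong) (auto, metis neqE)
  also have "\<dots> = pair_sgn A (\<lambda>x y. x < y \<and> R x y) * pair_sgn A (\<lambda>x y. y < x \<and> R x y)"
    by (simp add: pair_sgn_mult)
  also have "pair_sgn A (\<lambda>x y. y < x \<and> R x y) = pair_sgn A (\<lambda>x y. x < y \<and> R y x)"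
    by (rule pair_sgn_swap)
  finally show ?thesis
    unfolding pair_sgn_mult by (auto intro: pair_sgn_cong)
qed

section \<open>Signs of permutations and words\<close>

text \<open>The inversions are \<open>(a, b)\<close> and, for every \<open>z\<close> strictly
  between, \<open>(a, z)\<close> and \<open>(z, b)\<close>. The last two families are equally large,
  so their signs cancel.\<close>

lemma pair_sgn_transpose:
  fixes A :: "'a::linorder set"
  assumes "finite A" "a \<in> A" "b \<in> A" "a < b"
  shows "pair_sgn A (\<lambda>x y. x < y \<and> transpose a b x > transpose a b y) = -1"
proof -
  let ?M = "\<lambda>z. a < z \<and> z < b"
  have row: "pair_sgn A (\<lambda>x y. x = c \<and> P y) = (\<Prod>y\<in>A. if P y then -1 else 1)"
    if "c \<in> A" for c P
  proof -
    have "pair_sgn A (\<lambda>x y. x = c \<and> P y)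
        = (\<Prod>x\<in>A. if x = c then (\<Prod>y\<in>A. if P y then -1 else 1) else 1)"
      unfolding pair_sgn_def by (intro prod.cong refl) auto
    then show ?thesis using that assms(1) by simp
  qed
  have "pair_sgn A (\<lambda>x y. x < y \<and> transpose a b x > transpose a b y)
      = pair_sgn A (\<lambda>x y. (x = a \<and> y = b) \<noteq> ((x = a \<and> ?M y) \<noteq> (y = b \<and> ?M x)))"
    using assms(4) by (intro pair_sgn_cong) (auto simp: transpose_def)
  also have "\<dots> = pair_sgn A (\<lambda>x y. x = a \<and> y = b)
      * (pair_sgn A (\<lambda>x y. x = a \<and> ?M y) * pair_sgn A (\<lambda>x y. y = b \<and> ?M x))"
    by (simp only: pair_sgn_mult)
  also have "pair_sgn A (\<lambda>x y. y = b \<and> ?M x) = pair_sgn A (\<lambda>x y. x = b \<and> ?M y)"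
    by (rule pair_sgn_swap)
  \<comment> \<open>By \<open>row\<close>, the value does not depend on which element of
    \<open>A\<close> the first entry is pinned to.\<close>
  also have "\<dots> = pair_sgn A (\<lambda>x y. x = a \<and> ?M y)"
    unfolding row[OF assms(2)] row[OF assms(3)] ..
  also have "pair_sgn A (\<lambda>x y. x = a \<and> ?M y) * \<dots> = 1"
    unfolding pair_sgn_mult by (simp add: pair_sgn_def)
  finally show ?thesis
    using assms by (simp add: row)
qed

text \<open>Induction over transpositions: composing with one negates \<open>sign\<close>, and by
  \<open>pair_sgn_transpose\<close> it negates the inversion sign as well.\<close>

lemma sign_eq_pair_sgn:
  fixes S :: "'a::linorder set"
  assumes "p permutes S" "finite S"
  shows "sign p = pair_sgn S (\<lambda>x y. x < y \<and> p x > p y)"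
  using assms
proof (induction rule: permutes_induct)
  case id
  show ?case by (simp add: pair_sgn_False[where R = "\<lambda>x y. x < y \<and> y < x"] less_not_sym)
next
  case (swap a b p)
  let ?t = "transpose a b"
  have p_inj: "p x = p y \<longleftrightarrow> x = y" for x y
    using permutes_inj[OF \<open>p permutes S\<close>] by (auto dest: injD)
  have t_inj: "?t x = ?t y \<longleftrightarrow> x = y" for x y
    by (metis transpose_involutory)
  have t: "pair_sgn S (\<lambda>x y. x < y \<and> ?t x > ?t y) = -1"
  proof (cases "a < b")
    case True
    then show ?thesis using swap assms(2) by (intro pair_sgn_transpose)
  next
    case False
    then show ?thesis
      using swap assms(2) pair_sgn_transpose[of S b a] by (simp add: transpose_commute)
  qed
  have "sign (?t \<circ> p) = - sign p"
    using swap assms(2) by (simp add: sign_compose sign_swap_id permutation_swap_id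
        permutes_imp_permutation)
  also have "\<dots> = sign p * pair_sgn S (\<lambda>x y. x < y \<and> ?t x > ?t y)"
    using t by simp
  also have "pair_sgn S (\<lambda>x y. x < y \<and> ?t x > ?t y)
      = pair_sgn S (\<lambda>x y. p x < p y \<and> ?t (p x) > ?t (p y))"
    using \<open>p permutes S\<close> by (intro pair_sgn_bij permutes_imp_bij)
  \<comment> \<open>After folding, the relation says that the transposition reverses the order of
    \<open>p x\<close> and \<open>p y\<close>. Its exclusive or with the inversions of
    \<open>p\<close> gives the inversions of the composition.\<close>
  also have "\<dots> = pair_sgn S (\<lambda>x y. x < y \<and>
      (p x < p y \<and> ?t (p x) > ?t (p y)) \<noteq> (p y < p x \<and> ?t (p y) > ?t (p x)))"
    by (rule pair_sgn_split_order) simp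
  also have "sign p * \<dots> = pair_sgn S (\<lambda>x y. x < y \<and> ?t (p x) > ?t (p y))"
    unfolding swap.IH pair_sgn_mult
    by (rule pair_sgn_cong) (auto, (metis neqE p_inj t_inj less_asym less_irrefl)+)
  finally show ?case by (simp add: o_def)
qed

lemma msgn_eq_pair_sgn: "msgn w = pair_sgn {..<length w} (\<lambda>i j. i < j \<and> w ! i > w ! j)"
proof -
  have *: "{(i, j). i < j \<and> j < length w \<and> w ! i > w ! j}
      = {(i, j). i \<in> {..<length w} \<and> j \<in> {..<length w} \<and> i < j \<and> w ! i > w ! j}"
    by auto
  show ?thesis unfolding msgn_def * by (simp add: pair_sgn_card)
qed

text \<open>Indexing into the sorted list is an increasing bijection from positions to
  elements.\<close>

lemma msgn_map_sorted_list:
  fixes A :: "'a::linorder set"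
  assumes "finite A"
  shows "msgn (map f (sorted_list_of_set A)) = pair_sgn A (\<lambda>x y. x < y \<and> f x > f y)"
proof -
  let ?w = "sorted_list_of_set A"
  have len: "length ?w = card A" by simp
  have "sorted_wrt (<) ?w" by simp
  then have less: "?w ! i < ?w ! j" if "i < j" "j < card A" for i j
    using that by (simp add: sorted_wrt_iff_nth_less)
  have less_iff: "?w ! i < ?w ! j \<longleftrightarrow> i < j" if "i < card A" "j < card A" for i j
    using less[of i j] less[of j i] that by (metis less_asym less_irrefl neqE)
  have bij: "bij_betw ((!) ?w) {..<card A} A"
    by (rule bij_betw_nth) (use assms in auto)
  show ?thesis
    unfolding msgn_eq_pair_sgn pair_sgn_bij[OF bij]
    by (rule pair_sgn_cong) (auto simp: less_iff)
qed

lemma perm_of_word_permutes: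
  assumes "w \<in> permutations_of_set {1..n}"
  shows "perm_of_word w permutes {1..n}"
proof -
  have w: "set w = {1..n}" "distinct w" using assms by (auto dest: permutations_of_setD)
  then have len: "length w = n" using distinct_card by fastforce
  have "bij_betw (\<lambda>i. w ! (i - 1)) {1..n} {1..n}"
  proof -
    have "bij_betw (\<lambda>i. i - 1) {1..n} {..<n}"
      by (rule bij_betw_byWitness[where f' = Suc]) auto
    moreover have "bij_betw ((!) w) {..<n} {1..n}"
      using w len by (intro bij_betw_nth) auto
    ultimately show ?thesis using bij_betw_trans by (force simp: o_def)
  qed
  then have "bij_betw (perm_of_word w) {1..n} {1..n}"
    by (rule bij_betw_cong[THEN iffD1, rotated]) (simp add: perm_of_word_def len)
  then show ?thesis
    by (rule bij_imp_permutes) (auto simp: perm_of_word_def len)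
qed

lemma sign_perm_of_word:
  assumes "w \<in> permutations_of_set {1..n}"
  shows "sign (perm_of_word w) = msgn w"
proof -
  have len: "length w = n"
    using assms by (metis length_finite_permutations_of_set card_atLeastAtMost diff_Suc_1)
  \<comment> \<open>Word positions start at 0, arguments of \<open>perm_of_word\<close> at 1; the
    shift is increasing, so inversions correspond.\<close>
  have bij: "bij_betw Suc {..<n} {1..n}"
    by (rule bij_betw_byWitness[where f' = "\<lambda>i. i - 1"]) auto
  have "sign (perm_of_word w)
      = pair_sgn {1..n} (\<lambda>x y. x < y \<and> perm_of_word w x > perm_of_word w y)"
    using perm_of_word_permutes[OF assms] by (rule sign_eq_pair_sgn) simp
  also have "\<dots> = msgn w"
    unfolding msgn_eq_pair_sgn pair_sgn_bij[OF bij] len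
    by (rule pair_sgn_cong) (auto simp: perm_of_word_def len)
  finally show ?thesis .
qed

section \<open>Cells and partial Latin hypercubes\<close>

lemma finite_cells: "finite (cells k d)"
  unfolding cells_def using finite_lists_length_eq[of "{1..k}" d] by (simp add: conj_commute)

lemma coord_in_range: "a \<in> cells k d \<Longrightarrow> l \<in> {1..d} \<Longrightarrow> coord a l \<in> {1..k}"
proof -
  assume "a \<in> cells k d" "l \<in> {1..d}"
  then have "a ! (l - 1) \<in> set a" "set a \<subseteq> {1..k}" by (auto simp: cells_def)
  then show ?thesis unfolding coord_def by blast
qed

text \<open>The head of the list dominates the lexicographic order. This is what distinguishes
  direction 1 from the others.\<close>

lemma cell_less_imp_coord_1_le:
  assumes "x \<in> cells k d" "y \<in> cells k d" "0 < d" "x < y"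
  shows "coord x 1 \<le> coord y 1"
  using assms by (cases x; cases y) (auto simp: cells_def coord_def)

lemma cell_eqI:
  assumes "a \<in> cells k d" "b \<in> cells k d" "\<And>l. l \<in> {1..d} \<Longrightarrow> coord a l = coord b l"
  shows "a = b"
proof (rule nth_equalityI)
  show "length a = length b" using assms by (simp add: cells_def)
  show "a ! i = b ! i" if "i < length a" for i
    using assms(3)[of "Suc i"] that assms(1) by (simp add: cells_def coord_def)
qed

lemma coord_Cons_map:
  assumes "l \<in> {2..d}"
  shows "coord (j # map f [2..<d + 1]) l = f l"
proof -
  have "l - 1 = Suc (l - 2)" "l - 2 < length [2..<d + 1]" "[2..<d + 1] ! (l - 2) = l"
    using assms by (auto simp del: upt_Suc)
  then show ?thesis unfolding coord_def by (simp del: upt_Suc)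
qed

lemma coord_Cons_1: "coord (j # w) 1 = j"
  by (simp add: coord_def)

section \<open>Slices and the bijections they induce\<close>

locale latin_hypercube =
  fixes d k n :: nat and T :: "nat list set" and C :: "nat list \<Rightarrow> nat"
  assumes d: "0 < d" and T_cells: "T \<subseteq> cells k d" and plh: "partial_latin_hypercube k d n T C"
begin

lemma finite_T: "finite T"
  using T_cells finite_cells finite_subset by blast

lemma C_nonzero_iff: "a \<in> cells k d \<Longrightarrow> C a \<noteq> 0 \<longleftrightarrow> a \<in> T"
  using plh unfolding partial_latin_hypercube_def by blast

lemma C_range: "a \<in> T \<Longrightarrow> C a \<in> {1..n}"
  using plh T_cells C_nonzero_iff[of a] unfolding partial_latin_hypercube_def by fastforce

text \<open>Filtering a sorted list leaves the sorted list of the filtered set, and the cells with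
  nonzero value are those of \<open>T\<close>.\<close>

lemma C_word_slice: "C_word C (slice k d l j) = map C (sorted_list_of_set {x \<in> T. coord x l = j})"
proof -
  have fin: "finite (slice k d l j)"
    using finite_cells by (simp add: slice_def)
  have eq: "{x \<in> T. coord x l = j} = {x \<in> slice k d l j. C x \<noteq> 0}"
    using T_cells C_nonzero_iff by (auto simp: slice_def)
  have "filter (\<lambda>x. C x \<noteq> 0) (sorted_list_of_set (slice k d l j))
      = sorted_list_of_set {x \<in> slice k d l j. C x \<noteq> 0}"
    using fin by (intro sorted_distinct_set_unique) (auto simp: sorted_wrt_filter)
  then show ?thesis unfolding C_word_def eq by (simp add: filter_map o_def)
qed

lemma C_word_permutation:
  "l \<in> {1..d} \<Longrightarrow> j \<in> {1..k} \<Longrightarrow>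
    map C (sorted_list_of_set {x \<in> T. coord x l = j}) \<in> permutations_of_set {1..n}"
  using plh unfolding partial_latin_hypercube_def C_word_slice[symmetric] by blast

lemma C_bij_slice:
  assumes "l \<in> {1..d}" "j \<in> {1..k}"
  shows "bij_betw C {x \<in> T. coord x l = j} {1..n}"
  using permutations_of_setD[OF C_word_permutation[OF assms]] finite_T
  by (auto simp: bij_betw_def distinct_map)

lemma coord_C_bij:
  assumes "l \<in> {1..d}"
  shows "bij_betw (\<lambda>x. (coord x l, C x)) T ({1..k} \<times> {1..n})"
proof (rule bij_betwI')
  fix x y assume xy: "x \<in> T" "y \<in> T"
  then have "coord x l \<in> {1..k}" using T_cells assms coord_in_range by blast
  then have "inj_on C {z \<in> T. coord z l = coord x l}"
    using C_bij_slice assms bij_betw_imp_inj_on by blast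
  then show "(coord x l, C x) = (coord y l, C y) \<longleftrightarrow> x = y"
    using xy by (auto dest: inj_onD)
next
  fix x assume "x \<in> T"
  then show "(coord x l, C x) \<in> {1..k} \<times> {1..n}"
    using T_cells assms coord_in_range C_range by blast
next
  fix p assume "p \<in> {1..k} \<times> {1..n}"
  then obtain j c where p: "p = (j, c)" "j \<in> {1..k}" "c \<in> {1..n}" by blast
  then have "c \<in> C ` {x \<in> T. coord x l = j}"
    using C_bij_slice[OF assms p(2)] by (simp add: bij_betw_def)
  then show "\<exists>x\<in>T. p = (coord x l, C x)" using p by auto
qed

lemma dir_sgn_eq_pair_sgn:
  assumes "l \<in> {1..d}"
  shows "dir_sgn k d l C = pair_sgn T (\<lambda>x y. coord x l = coord y l \<and> x < y \<and> C x > C y)"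
proof -
  have "dir_sgn k d l C = (\<Prod>j=1..k. pair_sgn {x \<in> T. coord x l = j} (\<lambda>x y. x < y \<and> C x > C y))"
    unfolding dir_sgn_def C_word_slice
  proof (rule prod.cong[OF refl])
    fix j assume "j \<in> {1..k}"
    from sign_perm_of_word[OF C_word_permutation[OF assms this]]
    show "sign (perm_of_word (map C (sorted_list_of_set {x \<in> T. coord x l = j})))
        = pair_sgn {x \<in> T. coord x l = j} (\<lambda>x y. x < y \<and> C x > C y)"
      using finite_T by (simp add: msgn_map_sorted_list)
  qed
  also have "\<dots> = pair_sgn T (\<lambda>x y. coord x l = coord y l \<and> x < y \<and> C x > C y)"
    using finite_T T_cells assms coord_in_range by (intro pair_sgn_fibres) blast+
  finally show ?thesis .
qed

section \<open>The permutations attached to a symbol\<close>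

lemma symbol_cells:
  assumes "i \<in> {1..n}"
  shows "{a \<in> cells k d. C a = i} = {a \<in> T. C a = i}"
  using T_cells C_nonzero_iff assms by force

text \<open>The bijection \<open>coord_C_bij\<close> restricted to a fixed symbol, where
  \<open>C_bij_slice\<close> fixes the coordinate.\<close>

lemma coord_bij_symbol:
  assumes "l \<in> {1..d}" "i \<in> {1..n}"
  shows "bij_betw (\<lambda>x. coord x l) {a \<in> T. C a = i} {1..k}"
proof (rule bij_betwI')
  note bij = coord_C_bij[OF assms(1)]
  fix x y assume "x \<in> {a \<in> T. C a = i}" "y \<in> {a \<in> T. C a = i}"
  then show "coord x l = coord y l \<longleftrightarrow> x = y"
    using bij_betw_imp_inj_on[OF bij] by (auto dest: inj_onD)
next
  fix x assume "x \<in> {a \<in> T. C a = i}"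
  then show "coord x l \<in> {1..k}" using T_cells assms coord_in_range by blast
next
  fix j assume "j \<in> {1..k}"
  then have "(j, i) \<in> (\<lambda>x. (coord x l, C x)) ` T"
    using coord_C_bij[OF assms(1)] assms(2) by (simp add: bij_betw_def)
  then show "\<exists>x\<in>{a \<in> T. C a = i}. j = coord x l" by auto
qed

text \<open>Justifies the \<open>THE\<close> in \<open>symbol_perms\<close>.\<close>

lemma symbol_perms_ex1:
  assumes i: "i \<in> {1..n}"
  shows "\<exists>!\<pi>. (\<forall>l\<in>{2..d}. \<pi> l permutes {1..k}) \<and> (\<forall>l. l \<notin> {2..d} \<longrightarrow> \<pi> l = id) \<and>
     {a \<in> cells k d. C a = i} = {j # map (\<lambda>l. \<pi> l j) [2..<d + 1] | j. j \<in> {1..k}}"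
proof (rule ex_ex1I)
  let ?S = "{a \<in> T. C a = i}"
  \<comment> \<open>\<open>g j\<close> is the only cell with symbol \<open>i\<close> and first
    coordinate \<open>j\<close>; its other coordinates are the values of the permutations at
    \<open>j\<close>.\<close>
  define g where "g = the_inv_into ?S (\<lambda>x. coord x 1)"
  define \<pi> where "\<pi> l = (if l \<in> {2..d} then (\<lambda>j. if j \<in> {1..k} then coord (g j) l else j) else id)"
    for l
  have bij1: "bij_betw (\<lambda>x. coord x 1) ?S {1..k}"
    using coord_bij_symbol[of 1] d i by simp
  then have g: "bij_betw g {1..k} ?S"
    unfolding g_def by (rule bij_betw_the_inv_into)
  have g1: "coord (g j) 1 = j" if "j \<in> {1..k}" for j
    unfolding g_def using f_the_inv_into_f_bij_betw[OF bij1] that by blast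
  have perm: "\<pi> l permutes {1..k}" if l: "l \<in> {2..d}" for l
  proof (rule bij_imp_permutes)
    have "bij_betw ((\<lambda>x. coord x l) \<circ> g) {1..k} {1..k}"
      by (rule bij_betw_trans[OF g]) (use coord_bij_symbol l i in auto)
    then show "bij_betw (\<pi> l) {1..k} {1..k}"
      by (rule bij_betw_cong[THEN iffD1, rotated]) (use l in \<open>simp add: \<pi>_def\<close>)
  qed (use l in \<open>auto simp: \<pi>_def\<close>)
  have cell: "g j = j # map (\<lambda>l. \<pi> l j) [2..<d + 1]" if j: "j \<in> {1..k}" for j
  proof (rule cell_eqI)
    show "g j \<in> cells k d" using bij_betwE[OF g] j T_cells by blast
    have "\<pi> l j \<in> {1..k}" if "l \<in> {2..d}" for l
      using permutes_in_image[OF perm[OF that]] j by blast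
    then show "j # map (\<lambda>l. \<pi> l j) [2..<d + 1] \<in> cells k d"
      using j d by (auto simp: cells_def simp del: upt_Suc)
    show "coord (g j) l = coord (j # map (\<lambda>l. \<pi> l j) [2..<d + 1]) l" if l: "l \<in> {1..d}" for l
    proof (cases "l = 1")
      case True
      then show ?thesis using g1[OF j] by (simp add: coord_Cons_1 del: upt_Suc One_nat_def)
    next
      case False
      then have "l \<in> {2..d}" using l by auto
      then show ?thesis using j by (simp only: coord_Cons_map) (simp add: \<pi>_def)
    qed
  qed
  have "?S = g ` {1..k}" using g by (simp add: bij_betw_def)
  also have "\<dots> = {j # map (\<lambda>l. \<pi> l j) [2..<d + 1] | j. j \<in> {1..k}}"
    using cell by (auto simp del: upt_Suc)
  finally show "\<exists>\<pi>. (\<forall>l\<in>{2..d}. \<pi> l permutes {1..k}) \<and> (\<forall>l. l \<notin> {2..d} \<longrightarrow> \<pi> l = id) \<and>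
     {a \<in> cells k d. C a = i} = {j # map (\<lambda>l. \<pi> l j) [2..<d + 1] | j. j \<in> {1..k}}"
    using perm symbol_cells[OF i] by (intro exI[of _ \<pi>]) (simp add: \<pi>_def del: upt_Suc)
next
  fix \<pi> \<rho> :: "nat \<Rightarrow> nat \<Rightarrow> nat"
  let ?P = "\<lambda>\<pi>. (\<forall>l\<in>{2..d}. \<pi> l permutes {1..k}) \<and> (\<forall>l. l \<notin> {2..d} \<longrightarrow> \<pi> l = id) \<and>
     {a \<in> cells k d. C a = i} = {j # map (\<lambda>l. \<pi> l j) [2..<d + 1] | j. j \<in> {1..k}}"
  assume P: "?P \<pi>" and R: "?P \<rho>"
  have "\<pi> l j = \<rho> l j" if l: "l \<in> {2..d}" and j: "j \<in> {1..k}" for l j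
  proof -
    have "j # map (\<lambda>l. \<pi> l j) [2..<d + 1] \<in> {a \<in> cells k d. C a = i}"
      using P j by blast
    \<comment> \<open>Only one member of the set described by \<rho> has head
      \<open>j\<close>.\<close>
    then have "j # map (\<lambda>l. \<pi> l j) [2..<d + 1] = j # map (\<lambda>l. \<rho> l j) [2..<d + 1]"
      using R by auto
    then show ?thesis using coord_Cons_map[OF l] by metis
  qed
  moreover have "\<pi> l j = \<rho> l j" if l: "l \<in> {2..d}" and j: "j \<notin> {1..k}" for l j
  proof -
    have "\<pi> l permutes {1..k}" "\<rho> l permutes {1..k}" using P R l by blast+
    then show ?thesis using permutes_not_in j by metis
  qed
  moreover have "\<pi> l = \<rho> l" if "l \<notin> {2..d}" for l
  proof -
    have "\<pi> l = id" "\<rho> l = id" using P R that by blast+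
    then show ?thesis by simp
  qed
  ultimately have "\<pi> l j = \<rho> l j" for l j by metis
  then show "\<pi> = \<rho>" by blast
qed

text \<open>Parametrising the symbol class by its first coordinate is increasing, as that coordinate
  is the head of the list; hence inversions of the permutation become pairs of cells.\<close>

lemma sign_symbol_perms:
  assumes i: "i \<in> {1..n}" and l: "l \<in> {2..d}"
  shows "sign (symbol_perms k d C i l)
    = pair_sgn {a \<in> T. C a = i} (\<lambda>x y. x < y \<and> coord x l > coord y l)"
proof -
  let ?\<pi> = "symbol_perms k d C i"
  let ?g = "\<lambda>j. j # map (\<lambda>l. ?\<pi> l j) [2..<d + 1]"
  have P: "(\<forall>l\<in>{2..d}. ?\<pi> l permutes {1..k}) \<and> (\<forall>l. l \<notin> {2..d} \<longrightarrow> ?\<pi> l = id) \<and>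
     {a \<in> cells k d. C a = i} = {j # map (\<lambda>l. ?\<pi> l j) [2..<d + 1] | j. j \<in> {1..k}}"
    unfolding symbol_perms_def by (rule theI'[OF symbol_perms_ex1[OF i]])
  have "{a \<in> T. C a = i} = ?g ` {1..k}"
    using P unfolding symbol_cells[OF i] Setcompr_eq_image by blast
  then have bij: "bij_betw ?g {1..k} {a \<in> T. C a = i}"
    by (auto simp: bij_betw_def inj_on_def)
  have "?\<pi> l permutes {1..k}" using P l by blast
  then have "sign (?\<pi> l) = pair_sgn {1..k} (\<lambda>x y. x < y \<and> ?\<pi> l x > ?\<pi> l y)"
    by (rule sign_eq_pair_sgn) simp
  also have "\<dots> = pair_sgn {a \<in> T. C a = i} (\<lambda>x y. x < y \<and> coord x l > coord y l)"
    unfolding pair_sgn_bij[OF bij] coord_Cons_map[OF l]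
    by (rule pair_sgn_cong) (auto simp del: upt_Suc)
  finally show ?thesis .
qed

section \<open>Comparison of signs in a single direction\<close>

lemma msgn_coord_word:
  "msgn (coord_word T l) = pair_sgn T (\<lambda>x y. x < y \<and> coord x l > coord y l)"
  unfolding coord_word_def using finite_T by (rule msgn_map_sorted_list)

lemma direction_identity:
  assumes l: "l \<in> {2..d}"
  shows "dir_sgn k d 1 C * dir_sgn k d l C * (\<Prod>i=1..n. sign (symbol_perms k d C i l))
    = msgn (coord_word T l)"
proof -
  \<comment> \<open>The sign of the pairs with ascending coordinate and descending symbol, folded
    onto \<open>x < y\<close> to be compatible with the other factors.\<close>
  let ?W = "\<lambda>l. pair_sgn T (\<lambda>x y. x < y \<and>
    (coord x l < coord y l \<and> C x > C y) \<noteq> (coord y l < coord x l \<and> C y > C x))"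
  have W: "?W m = pair_sgn ({1..k} \<times> {1..n}) (\<lambda>p q. fst p < fst q \<and> snd p > snd q)"
    if "m \<in> {1..d}" for m
    unfolding pair_sgn_bij[OF coord_C_bij[OF that]]
    by (subst pair_sgn_split_order) auto
  have "?W 1 * ?W l = ?W 1 * ?W 1"
    using W[of l] W[of 1] l by simp
  also have "\<dots> = 1"
    by (simp add: pair_sgn_mult pair_sgn_False)
  finally have W1: "?W 1 * ?W l = 1" .
  have ss: "(\<Prod>i=1..n. sign (symbol_perms k d C i l))
      = pair_sgn T (\<lambda>x y. C x = C y \<and> x < y \<and> coord x l > coord y l)"
  proof -
    have "(\<Prod>i=1..n. sign (symbol_perms k d C i l))
        = (\<Prod>i=1..n. pair_sgn {a \<in> T. C a = i} (\<lambda>x y. x < y \<and> coord x l > coord y l))"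
      using l by (intro prod.cong refl sign_symbol_perms)
    also have "\<dots> = pair_sgn T (\<lambda>x y. C x = C y \<and> x < y \<and> coord x l > coord y l)"
      using C_range finite_T by (intro pair_sgn_fibres) auto
    finally show ?thesis .
  qed
  have l1: "1 \<in> {1..d}" "l \<in> {1..d}" using l by auto
  have "dir_sgn k d 1 C * dir_sgn k d l C * (\<Prod>i=1..n. sign (symbol_perms k d C i l))
      = dir_sgn k d 1 C * dir_sgn k d l C * (\<Prod>i=1..n. sign (symbol_perms k d C i l)) * (?W 1 * ?W l)"
    unfolding W1 by simp
  also have "\<dots> = msgn (coord_word T l)"
    unfolding ss dir_sgn_eq_pair_sgn[OF l1(1)] dir_sgn_eq_pair_sgn[OF l1(2)] pair_sgn_mult
      msgn_coord_word
  proof (rule pair_sgn_cong[OF refl], goal_cases)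
    case (1 x y)
    \<comment> \<open>For \<open>x < y\<close> this makes direction 1 together with
      \<open>?W 1\<close> collapse to \<open>C x > C y\<close>. Direction \<open>l\<close> with
      \<open>?W l\<close> yields \<open>coord x l \<le> coord y l\<close> if
      \<open>C x > C y\<close> and \<open>coord x l > coord y l\<close> if \<open>C x < C y\<close>;
      the symbol factor handles \<open>C x = C y\<close>. In all three cases the exclusive or is
      \<open>coord x l > coord y l\<close>.\<close>
    have "x < y \<Longrightarrow> coord x 1 \<le> coord y 1"
      using 1 T_cells d cell_less_imp_coord_1_le by blast
    then show ?case
      by (cases "x < y"; cases "C x" "C y" rule: linorder_cases;
          cases "coord x l" "coord y l" rule: linorder_cases) auto
  qed
  finally show ?thesis .
qed

lemma msgn_coord_word_1: "msgn (coord_word T 1) = 1"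
  unfolding msgn_coord_word
  using T_cells d cell_less_imp_coord_1_le by (intro pair_sgn_False) (meson leD subsetD)

end

theorem theorem7p12:
  fixes d k n :: nat and T :: "nat list set" and C :: "nat list \<Rightarrow> nat"
  assumes "d > 2" and "k > 0" and "n > 0"
    and "magic_set k d T" and "card T = n * k"
    and "partial_latin_hypercube k d n T C"
  shows "dir_sgn k d 1 C ^ (d - 1) * (\<Prod>l=2..d. dir_sgn k d l C) * ssgn k d n C = set_sgn d T"
proof -
  interpret latin_hypercube d k n T C
    using assms by unfold_locales (auto simp: magic_set_def)
  have "ssgn k d n C = (\<Prod>l=2..d. \<Prod>i=1..n. sign (symbol_perms k d C i l))"
    unfolding ssgn_def subsign_def by (rule prod.swap)
  \<comment> \<open>One copy of the sign in direction 1 goes to each of the \<open>d - 1\<close>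
    directions from 2 on, so the product splits into instances of
    \<open>direction_identity\<close>.\<close>
  moreover have "dir_sgn k d 1 C ^ (d - 1) = (\<Prod>l=2..d. dir_sgn k d 1 C)"
    by simp
  ultimately have "dir_sgn k d 1 C ^ (d - 1) * (\<Prod>l=2..d. dir_sgn k d l C) * ssgn k d n C
      = (\<Prod>l=2..d. msgn (coord_word T l))"
    by (simp only: prod.distrib[symmetric]) (intro prod.cong refl direction_identity)
  also have "\<dots> = set_sgn d T"
  proof -
    have "{1..d} = insert 1 {2..d}" using assms(1) by auto
    then show ?thesis using msgn_coord_word_1 by (simp add: set_sgn_def)
  qed
  finally show ?thesis .
qed

end
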